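(* Let $E$ be a finite set and let $\mu'$ be a transversal valuated matroid on $E\sqcup\{*\}$ of rank $d$ such that $*$ is not a coloop of the underlying matroid $\underline{\mu'}$. Then $\mu'$ has a matrix presentation of the form $(A|x)$, with $A\in\mathbb T^{d\times E}$ and $x\in\mathbb T^d$ the column indexed by $*$, such that $A$ is a minimal matrix presentation of the deletion $\mu'\setminus *$.
   Context: $\mathbb T=\mathbb R\cup\{\infty\}$ with operations $\min$ and $+$. A valuated matroid of rank $d$ on a finite set $E$ is a function $\mu:\binom Ed\to\mathbb T$ such that $\mu^{-1}(\mathbb R)$ is the set of bases of a matroid $\underline{\mu}$ (the underlying matroid) and for all $S\in\binom E{d-2}$ and $i,j,k,l\notin S$ the minimum of $\mu_{Sij}+\mu_{Skl},\ \mu_{Sik}+\mu_{Sjl},\ \mu_{Sil}+\mu_{Sjk}$ is attained at least twice; functions differing by a global real constant are identified. The tropical Stiefel map $\pi$ sends $A\in\mathbb T^{d\times E}$ to $B\mapsto\min\{\sum_{i\in B}A_{\phi(i),i}:\phi:B\to[d]\text{ bijection}\}$ on $\binom Ed$. A matrix presentation of $\mu$ is a matrix $A\in\mathbb T^{d\times E}$ with $\pi(A)=\mu$, and $\mu$ is transversal if it has one. The deletion $\mu'\setminus *$ (defined when $*$ is not a coloop of $\underline{\mu'}$) is the restriction of $\mu'$ to $\binom Ed$. The support of $y\in\mathbb T^E$ is $\{j:y_j\ne\infty\}$. For a transversal matroid $M$ of rank $d$, a presentation is a multiset $\{\!\{A_1,\dots,A_d\}\!\}$ of subsets of the ground set whose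 bipartite matchings to $[d]$ (with $i$ adjacent to elements of $A_i$) give exactly the bases; presentations are ordered by $\mathcal A\le\mathcal A'$ if there is a bijection $f$ with $X\subseteq f(X)$, and minimal presentations are minimal in this order (equivalently each $A_i$ is a cocircuit). A matrix presentation $A$ of $\mu$ is minimal if the multiset of supports of its rows is a minimal presentation of $\underline{\mu}$. *)

theory Defs
  imports
    "HOL-Library.Extended_Real"
    "HOL-Library.FuncSet"
    "HOL-Library.Multiset"
    "HOL-Library.Ramsey"
begin

text \<open>
  The tropical numbers (the reals together with infinity, under min and plus) are rendered as
  the type \<^typ>\<open>ereal\<close> with the value \<open>-\<infinity>\<close> excluded by hypothesis wherever an object takes
  tropical values. The set of \<open>d\<close>-element subsets of \<open>E\<close> is \<^term>\<open>nsets E d\<close>. Functions and matrices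
  are total HOL functions of which only the values on \<^term>\<open>nsets E d\<close>, respectively at
  row indices in \<open>{..<d}\<close> and column indices in \<open>E\<close>, matter.
\<close>

definition tropical :: "ereal set" where
  "tropical = {t. t \<noteq> -\<infinity>}"


subsection \<open>Matroids\<close>

definition matroid_bases :: "'a set \<Rightarrow> 'a set set \<Rightarrow> bool" where
  "matroid_bases E \<B> \<longleftrightarrow>
     finite E \<and> \<B> \<subseteq> Pow E \<and> \<B> \<noteq> {} \<and>
     (\<forall>B1\<in>\<B>. \<forall>B2\<in>\<B>. \<forall>x\<in>B1 - B2. \<exists>y\<in>B2 - B1. insert y (B1 - {x}) \<in> \<B>)"

definition coloop :: "'a set set \<Rightarrow> 'a \<Rightarrow> bool" where
  "coloop \<B> e \<longleftrightarrow> (\<forall>B\<in>\<B>. e \<in> B)"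


subsection \<open>Presentations of transversal matroids\<close>

text \<open>
  The listing \<open>As\<close> only serves to index the members of the multiset by \<open>{..<d}\<close>; since it
  is combined with an arbitrary bijection, its choice is immaterial.
\<close>

definition matching_bases :: "'a set \<Rightarrow> 'a set multiset \<Rightarrow> 'a set set" where
  "matching_bases E \<A> =
     {B. B \<subseteq> E \<and>
         (\<exists>As \<phi>. mset As = \<A> \<and> bij_betw \<phi> B {..<length As} \<and> (\<forall>b\<in>B. b \<in> As ! \<phi> b))}"

definition set_presentation :: "'a set \<Rightarrow> nat \<Rightarrow> 'a set set \<Rightarrow> 'a set multiset \<Rightarrow> bool" where
  "set_presentation E d \<B> \<A> \<longleftrightarrow>
     size \<A> = d \<and> (\<forall>X\<in>#\<A>. X \<subseteq> E) \<and> matching_bases E \<A> = \<B>"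

text \<open>
  \<^term>\<open>rel_mset (\<subseteq>) \<A>' \<A>\<close> says that there is a bijection between the two multisets
  sending each member of \<open>\<A>'\<close> to a superset of it.
\<close>

definition minimal_set_presentation :: "'a set \<Rightarrow> nat \<Rightarrow> 'a set set \<Rightarrow> 'a set multiset \<Rightarrow> bool" where
  "minimal_set_presentation E d \<B> \<A> \<longleftrightarrow>
     set_presentation E d \<B> \<A> \<and>
     (\<forall>\<A>'. set_presentation E d \<B> \<A>' \<and> rel_mset (\<subseteq>) \<A>' \<A> \<longrightarrow> \<A>' = \<A>)"


subsection \<open>Valuated matroids\<close>

definition underlying_bases :: "'a set \<Rightarrow> nat \<Rightarrow> ('a set \<Rightarrow> ereal) \<Rightarrow> 'a set set" where
  "underlying_bases E d \<mu> = {B \<in> nsets E d. \<mu> B \<in> range ereal}"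

definition min_attained_twice :: "ereal \<Rightarrow> ereal \<Rightarrow> ereal \<Rightarrow> bool" where
  "min_attained_twice a b c \<longleftrightarrow>
     (a = b \<and> a \<le> c) \<or> (a = c \<and> a \<le> b) \<or> (b = c \<and> b \<le> a)"

definition valuated_matroid :: "'a set \<Rightarrow> nat \<Rightarrow> ('a set \<Rightarrow> ereal) \<Rightarrow> bool" where
  "valuated_matroid E d \<mu> \<longleftrightarrow>
     finite E \<and>
     (\<forall>B\<in>nsets E d. \<mu> B \<in> tropical) \<and>
     matroid_bases E (underlying_bases E d \<mu>) \<and>
     (\<forall>S i j k l. S \<subseteq> E \<and> card S + 2 = d \<and> {i, j, k, l} \<subseteq> E - S \<and> distinct [i, j, k, l] \<longrightarrow>
        min_attained_twice
          (\<mu> (S \<union> {i, j}) + \<mu> (S \<union> {k, l}))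
          (\<mu> (S \<union> {i, k}) + \<mu> (S \<union> {j, l}))
          (\<mu> (S \<union> {i, l}) + \<mu> (S \<union> {j, k})))"

text \<open>
  Valuated matroids are considered up to a global real constant. We work with
  representatives; this relation is equality of the classes.
\<close>

definition valuation_equiv :: "'a set \<Rightarrow> nat \<Rightarrow> ('a set \<Rightarrow> ereal) \<Rightarrow> ('a set \<Rightarrow> ereal) \<Rightarrow> bool" where
  "valuation_equiv E d \<mu> \<nu> \<longleftrightarrow> (\<exists>c::real. \<forall>B\<in>nsets E d. \<nu> B = \<mu> B + ereal c)"

definition valuated_deletion ::
    "'a set \<Rightarrow> nat \<Rightarrow> ('a set \<Rightarrow> ereal) \<Rightarrow> 'a \<Rightarrow> 'a set \<Rightarrow> ereal" where
  "valuated_deletion E d \<mu> e = restrict \<mu> (nsets (E - {e}) d)"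


subsection \<open>The tropical Stiefel map and matrix presentations\<close>

definition tropical_matrix :: "'a set \<Rightarrow> nat \<Rightarrow> (nat \<Rightarrow> 'a \<Rightarrow> ereal) \<Rightarrow> bool" where
  "tropical_matrix E d A \<longleftrightarrow> (\<forall>i<d. \<forall>j\<in>E. A i j \<in> tropical)"

text \<open>
  For finite \<open>B\<close> with \<open>card B = d\<close>, only finitely many values occur, so the infimum is a minimum.
\<close>

definition tropical_stiefel :: "nat \<Rightarrow> (nat \<Rightarrow> 'a \<Rightarrow> ereal) \<Rightarrow> 'a set \<Rightarrow> ereal" where
  "tropical_stiefel d A B = (INF \<phi>\<in>{\<phi>. bij_betw \<phi> B {..<d}}. \<Sum>i\<in>B. A (\<phi> i) i)"

definition matrix_presentation ::
    "'a set \<Rightarrow> nat \<Rightarrow> ('a set \<Rightarrow> ereal) \<Rightarrow> (nat \<Rightarrow> 'a \<Rightarrow> ereal) \<Rightarrow> bool" where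
  "matrix_presentation E d \<mu> A \<longleftrightarrow>
     tropical_matrix E d A \<and> valuation_equiv E d (tropical_stiefel d A) \<mu>"

definition transversal_valuated_matroid :: "'a set \<Rightarrow> nat \<Rightarrow> ('a set \<Rightarrow> ereal) \<Rightarrow> bool" where
  "transversal_valuated_matroid E d \<mu> \<longleftrightarrow>
     valuated_matroid E d \<mu> \<and> (\<exists>A. matrix_presentation E d \<mu> A)"

definition trop_support :: "'a set \<Rightarrow> ('a \<Rightarrow> ereal) \<Rightarrow> 'a set" where
  "trop_support E y = {j \<in> E. y j \<noteq> \<infinity>}"

definition row_supports :: "'a set \<Rightarrow> nat \<Rightarrow> (nat \<Rightarrow> 'a \<Rightarrow> ereal) \<Rightarrow> 'a set multiset" where
  "row_supports E d A = image_mset (\<lambda>i. trop_support E (A i)) (mset_set {..<d})"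

definition minimal_matrix_presentation ::
    "'a set \<Rightarrow> nat \<Rightarrow> ('a set \<Rightarrow> ereal) \<Rightarrow> (nat \<Rightarrow> 'a \<Rightarrow> ereal) \<Rightarrow> bool" where
  "minimal_matrix_presentation E d \<mu> A \<longleftrightarrow>
     matrix_presentation E d \<mu> A \<and>
     minimal_set_presentation E d (underlying_bases E d \<mu>) (row_supports E d A)"

text \<open>The block matrix \<open>(A|x)\<close> whose column \<open>x\<close> is indexed by \<open>e\<close>.\<close>

definition append_column :: "(nat \<Rightarrow> 'a \<Rightarrow> ereal) \<Rightarrow> 'a \<Rightarrow> (nat \<Rightarrow> ereal) \<Rightarrow> nat \<Rightarrow> 'a \<Rightarrow> ereal" where
  "append_column A e x = (\<lambda>i. (A i)(e := x i))"

end

theory Submission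
  imports Defs "HOL-Combinatorics.List_Permutation"
begin

text \<open>
  Among all presentations \<open>(A|x)\<close> of \<open>\<mu>'\<close>, take one for which \<open>A\<close> has the fewest finite entries.
  Fix a row \<open>i\<close>, let \<open>S\<close> be its support in \<open>E\<close> and let \<open>\<nu>\<close> be the valuated matroid of rank \<open>d - 1\<close>
  presented by the other rows. Lowering \<open>x\<^sub>i\<close> as far as \<open>\<mu>'\<close> permits keeps \<open>A\<close> unchanged, so no
  finite entry of row \<open>i\<close> in \<open>E\<close> can then be replaced by infinity. Hence each \<open>e \<in> S\<close> has a
  basis of \<open>\<nu>\<close> whose \<open>\<nu>\<close>-value, corrected by the row entries, strictly increases whenever
  \<open>e\<close> is swapped in for an element of the row's support. Compare these with a basis \<open>C \<subseteq> E\<close> that first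
  maximises \<open>|C - S|\<close> and then minimises the corrected value: valuated exchange forces
  \<open>C \<inter> S = {}\<close>. So \<open>\<nu>\<close> has a basis avoiding the support of row \<open>i\<close>, and since \<open>C \<union> {e}\<close> can be
  matched only by sending \<open>e\<close> to \<open>i\<close>, no element \<open>e\<close> of the support can be dropped.
\<close>

section \<open>Exchange along alternating paths, and its use in a weighted set family\<close>

text \<open>Start at \<open>e = f k\<close> and move to \<open>g k\<close>; whenever the value
  reached is \<open>f k'\<close> for a new index, move on to \<open>g k'\<close>. Injectivity
  prevents a return, so the path stops at some \<open>b\<close> outside the image of
  \<open>f\<close>. \<open>J\<close> collects the indices passed: swapping \<open>f\<close> and
  \<open>g\<close> there cancels all intermediate values and only trades \<open>e\<close> for
  \<open>b\<close>.\<close>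

lemma swap_exchange:
  fixes f g :: "'i \<Rightarrow> 'a"
  assumes "finite I" "inj_on f I" "inj_on g I" "e \<in> f ` I - g ` I"
  shows "\<exists>J\<subseteq>I. \<exists>b\<in>g ` I - f ` I.
    (\<lambda>i. if i \<in> J then g i else f i) ` I = insert b (f ` I - {e}) \<and>
    (\<lambda>i. if i \<in> J then f i else g i) ` I = insert e (g ` I - {b})"
  using assms
proof (induction "card I" arbitrary: I e rule: less_induct)
  case less
  from less.prems obtain k where k: "k \<in> I" "f k = e" by auto
  let ?K = "I - {k}"
  have fI: "f ` ?K = f ` I - {e}" using k less.prems(2) by (auto dest: inj_onD)
  have gI: "g ` ?K = g ` I - {g k}" using k less.prems(3) by (auto dest: inj_onD)
  have ne: "g k \<noteq> e" using k(1) less.prems(4) by blast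
  show ?case
  proof (cases "g k \<in> f ` I")
    case False
    have "(\<lambda>i. if i \<in> {k} then g i else f i) ` I = insert (g k) (f ` ?K)"
      using k by auto
    moreover have "(\<lambda>i. if i \<in> {k} then f i else g i) ` I = insert e (g ` ?K)"
      using k by auto
    ultimately show ?thesis
      using False k fI gI by (intro exI[of _ "{k}"] conjI bexI[of _ "g k"]) auto
  next
    case True
    \<comment> \<open>With \<open>k\<close> removed, \<open>g k\<close> is still a value of
      \<open>f\<close> but, by injectivity, no longer one of \<open>g\<close>. It becomes the start
      of the shorter path.\<close>
    have "\<exists>J\<subseteq>?K. \<exists>b\<in>g ` ?K - f ` ?K.
      (\<lambda>i. if i \<in> J then g i else f i) ` ?K = insert b (f ` ?K - {g k}) \<and>
      (\<lambda>i. if i \<in> J then f i else g i) ` ?K = insert (g k) (g ` ?K - {b})"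
    proof (rule less.hyps)
      show "card ?K < card I" using k less.prems(1) by (meson card_Diff1_less)
      show "g k \<in> f ` ?K - g ` ?K" using True ne fI gI by auto
      show "inj_on f ?K" "inj_on g ?K" "finite ?K"
        using less.prems by (auto intro: inj_on_subset)
    qed
    then obtain J b where J: "J \<subseteq> ?K" "b \<in> g ` ?K - f ` ?K"
      "(\<lambda>i. if i \<in> J then g i else f i) ` ?K = insert b (f ` ?K - {g k})"
      "(\<lambda>i. if i \<in> J then f i else g i) ` ?K = insert (g k) (g ` ?K - {b})"
      by (elim exE bexE conjE)
    have "b \<in> g ` I" using J(2) by blast
    moreover have "b \<noteq> e" using \<open>b \<in> g ` I\<close> less.prems(4) by blast
    ultimately have b: "b \<in> g ` I - f ` I" using J(2) unfolding fI by blast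
    have split: "h ` I = insert (h k) (h ` ?K)" for h :: "'i \<Rightarrow> 'a" using k(1) by blast
    have "(\<lambda>i. if i \<in> insert k J then g i else f i) ` I
        = insert (g k) ((\<lambda>i. if i \<in> J then g i else f i) ` ?K)"
      unfolding split by (simp cong: image_cong_simp)
    also have "\<dots> = insert b (f ` I - {e})"
      unfolding J(3) fI using True ne by blast
    finally have 1: "(\<lambda>i. if i \<in> insert k J then g i else f i) ` I = insert b (f ` I - {e})" .
    have "(\<lambda>i. if i \<in> insert k J then f i else g i) ` I
        = insert e ((\<lambda>i. if i \<in> J then f i else g i) ` ?K)"
      unfolding split using k(2) by (simp cong: image_cong_simp)
    also have "\<dots> = insert e (g ` I - {b})"
      unfolding J(4) gI using True b k(1) by blast
    finally have 2: "(\<lambda>i. if i \<in> insert k J then f i else g i) ` I = insert e (g ` I - {b})" .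
    show ?thesis
    proof (intro exI conjI bexI)
      show "insert k J \<subseteq> I" using J(1) k(1) by blast
    qed (fact 1 2 b)+
  qed
qed

text \<open>An extremal argument: take \<open>C\<close> avoiding \<open>s\<close> with
  \<open>C - S\<close> as large as possible and, among those, \<open>w C\<close> least. If
  \<open>e\<close> is in \<open>C \<inter> S\<close>, exchange it against the set that
  \<open>strict\<close> provides for \<open>e\<close>. One of the two new sets then gets strictly
  heavier, so the other must be lighter than \<open>C\<close>, against the choice of
  \<open>C\<close>. The set \<open>D\<close> handles the case where the exchange brings in
  \<open>s\<close>, which leaves the family of sets avoiding \<open>s\<close>.\<close>

lemma exchange_avoid:
  fixes w :: "'a set \<Rightarrow> real"
  assumes finN: "finite N" and finC: "\<And>C. C \<in> N \<Longrightarrow> finite C"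
    and exch: "\<And>C C' e. C \<in> N \<Longrightarrow> C' \<in> N \<Longrightarrow> e \<in> C - C' \<Longrightarrow>
      \<exists>b\<in>C' - C. insert b (C - {e}) \<in> N \<and> insert e (C' - {b}) \<in> N \<and>
        w (insert b (C - {e})) + w (insert e (C' - {b})) \<le> w C + w C'"
    and strict: "\<And>e. e \<in> S - {s} \<Longrightarrow> \<exists>C\<in>N. e \<notin> C \<and>
      (\<forall>b\<in>C \<inter> S. insert e (C - {b}) \<in> N \<longrightarrow> w C < w (insert e (C - {b})))"
    and D: "D \<in> N" "s \<notin> D" "\<And>b. b \<in> D \<inter> S \<Longrightarrow> insert s (D - {b}) \<in> N \<Longrightarrow>
      s \<in> S \<and> w D \<le> w (insert s (D - {b}))"
  shows "\<exists>C\<in>N. s \<notin> C \<and> C \<inter> S = {}"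
proof -
  define N0 where "N0 = {C \<in> N. s \<notin> C}"
  define m where "m = Max ((\<lambda>C. card (C - S)) ` N0)"
  define N1 where "N1 = {C \<in> N0. card (C - S) = m}"
  have fin0: "finite N0" and ne0: "N0 \<noteq> {}" using finN D unfolding N0_def by auto
  have m: "card (C - S) \<le> m" if "C \<in> N0" for C
    unfolding m_def using that fin0 by auto
  have "m \<in> (\<lambda>C. card (C - S)) ` N0" unfolding m_def using fin0 ne0 by (intro Max_in) auto
  hence ne1: "N1 \<noteq> {}" unfolding N1_def by auto
  have fin1: "finite N1" using fin0 unfolding N1_def by auto
  obtain C where C: "C \<in> N1" and minC: "\<And>C'. C' \<in> N1 \<Longrightarrow> w C \<le> w C'"
    using arg_min_if_finite[OF fin1 ne1, of w] by (meson not_le)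
  have CN: "C \<in> N" "s \<notin> C" "card (C - S) = m" using C unfolding N1_def N0_def by auto
  \<comment> \<open>The disjunction on \<open>b\<close> admits \<open>b = e\<close>, where the swap
    gives back \<open>C\<close>. This occurs below when \<open>D\<close> contains
    \<open>e\<close>.\<close>
  have swap: "b \<in> S \<and> w C \<le> w (insert b (C - {e}))"
    if "e \<in> C \<inter> S" "b \<noteq> s" "b \<in> S \<or> b \<notin> C" "insert b (C - {e}) \<in> N" for b e
  proof -
    have F0: "insert b (C - {e}) \<in> N0" using that CN unfolding N0_def by auto
    have bS: "b \<in> S"
    proof (rule ccontr)
      assume b: "b \<notin> S"
      have "insert b (C - {e}) - S = insert b (C - S)" using that b by auto
      hence "card (insert b (C - {e}) - S) = Suc m"
        using that b CN finC[OF CN(1)] by simp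
      thus False using m[OF F0] by simp
    qed
    hence "insert b (C - {e}) - S = C - S" using that by auto
    hence "insert b (C - {e}) \<in> N1" using F0 CN unfolding N1_def by simp
    thus ?thesis using bS minC by auto
  qed
  have "C \<inter> S = {}"
  proof (rule ccontr)
    assume "C \<inter> S \<noteq> {}"
    then obtain e where e: "e \<in> C \<inter> S" by auto
    hence "e \<in> S - {s}" using CN by auto
    then obtain C' where C': "C' \<in> N" "e \<notin> C'"
      "\<And>b. b \<in> C' \<inter> S \<Longrightarrow> insert e (C' - {b}) \<in> N \<Longrightarrow> w C' < w (insert e (C' - {b}))"
      using strict by blast
    obtain b where b: "b \<in> C' - C" "insert b (C - {e}) \<in> N" "insert e (C' - {b}) \<in> N"
      "w (insert b (C - {e})) + w (insert e (C' - {b})) \<le> w C + w C'"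
      using exch[OF CN(1) C'(1), of e] e C'(2) by blast
    have "b \<in> S \<and> w C \<le> w (insert b (C - {e}))"
    proof (cases "b = s")
      case False
      thus ?thesis using swap[OF e] b by auto
    next
      case True
      \<comment> \<open>\<open>?F\<close> cannot be compared with \<open>C\<close> directly, as it
        contains \<open>s\<close>. Trading \<open>s\<close> against \<open>D\<close> replaces it by
        some \<open>b'\<close>, giving a set to which \<open>swap\<close> applies. Since putting
        \<open>s\<close> into \<open>D\<close> in place of \<open>b'\<close> does not lower the
        weight, the exchange inequality leaves \<open>w C \<le> w ?F\<close>.\<close>
      let ?F = "insert s (C - {e})"
      have sF: "s \<in> ?F - D" using D by auto
      have F: "?F \<in> N" "?F - {s} = C - {e}" using b True CN by auto
      obtain b' where b': "b' \<in> D - ?F" "insert b' (C - {e}) \<in> N" "insert s (D - {b'}) \<in> N"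
        "w (insert b' (C - {e})) + w (insert s (D - {b'})) \<le> w ?F + w D"
        using exch[OF F(1) D(1) sF] unfolding F(2) by blast
      have "b' \<noteq> s" "b' \<in> S \<or> b' \<notin> C" using b' D e by auto
      from swap[OF e this b'(2)] D(3)[of b'] b' True show ?thesis by auto
    qed
    thus False using C'(3)[of b] b by auto
  qed
  thus ?thesis using CN by auto
qed

section \<open>Tropical minors: attainment, row expansion and exchange\<close>

text \<open>Bijections run from rows to columns, and the row set is arbitrary, so that a row can be
  removed without renumbering. If \<open>I\<close> and \<open>B\<close> have no bijection, the
  infimum is over the empty set and equals infinity.\<close>

definition min_transversal :: "'i set \<Rightarrow> ('i \<Rightarrow> 'a \<Rightarrow> ereal) \<Rightarrow> 'a set \<Rightarrow> ereal" where
  "min_transversal I A B = (INF f\<in>{f. bij_betw f I B}. \<Sum>i\<in>I. A i (f i))"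

lemma tropical_stiefel_eq_min_transversal:
  "tropical_stiefel d A B = min_transversal {..<d} A B"
proof -
  have eq: "(\<Sum>b\<in>B. A (\<phi> b) b) = (\<Sum>i<d. A i (f i))"
    if "bij_betw f {..<d} B" "\<And>i. i < d \<Longrightarrow> \<phi> (f i) = i" for f :: "nat \<Rightarrow> 'a" and \<phi>
    using that(2) by (subst sum.reindex_bij_betw[OF that(1), symmetric]) auto
  show ?thesis unfolding tropical_stiefel_def min_transversal_def
  proof (intro antisym INF_mono)
    fix f assume "f \<in> {f. bij_betw f {..<d} B}"
    hence f: "bij_betw f {..<d} B" by simp
    show "\<exists>\<phi>\<in>{\<phi>. bij_betw \<phi> B {..<d}}. (\<Sum>b\<in>B. A (\<phi> b) b) \<le> (\<Sum>i<d. A i (f i))"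
      using f by (intro bexI[of _ "inv_into {..<d} f"] eq_refl eq)
        (auto simp: bij_betw_inv_into bij_betw_inv_into_left)
  next
    fix \<phi> assume "\<phi> \<in> {\<phi>. bij_betw \<phi> B {..<d}}"
    hence f: "bij_betw \<phi> B {..<d}" by simp
    show "\<exists>f\<in>{f. bij_betw f {..<d} B}. (\<Sum>i<d. A i (f i)) \<le> (\<Sum>b\<in>B. A (\<phi> b) b)"
      using f by (intro bexI[of _ "inv_into B \<phi>"] eq_refl eq[symmetric])
        (auto simp: bij_betw_inv_into bij_betw_inv_into_right)
  qed
qed

lemma min_transversal_le:
  "bij_betw f I B \<Longrightarrow> min_transversal I A B \<le> (\<Sum>i\<in>I. A i (f i))"
  unfolding min_transversal_def by (intro INF_lower) simp

lemma min_transversal_attained: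
  assumes "finite I" "bij_betw h I B"
  obtains f where "bij_betw f I B" "min_transversal I A B = (\<Sum>i\<in>I. A i (f i))"
proof -
  let ?s = "\<lambda>f. \<Sum>i\<in>I. A i (f i)"
  let ?V = "?s ` {f. bij_betw f I B}"
  have finB: "finite B" using assms bij_betw_finite by blast
  \<comment> \<open>There may be infinitely many total functions restricting to a bijection, but a
    sum sees only the restriction to \<open>I\<close>. Hence only finitely many values
    occur.\<close>
  have "?V \<subseteq> ?s ` (I \<rightarrow>\<^sub>E B)"
  proof
    fix v assume "v \<in> ?V"
    then obtain f where f: "bij_betw f I B" "v = ?s f" by auto
    have "restrict f I \<in> I \<rightarrow>\<^sub>E B" using f(1) bij_betwE by (intro PiE_I) auto
    moreover have "v = ?s (restrict f I)" using f(2) by simp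
    ultimately show "v \<in> ?s ` (I \<rightarrow>\<^sub>E B)" by blast
  qed
  hence "finite ?V" using finite_PiE[of I "\<lambda>_. B"] assms(1) finB by (meson finite_imageI finite_subset)
  moreover have "?V \<noteq> {}" using assms(2) by auto
  ultimately have "Inf ?V \<in> ?V" by (subst cInf_eq_Min) (assumption | rule Min_in)+
  thus ?thesis using that unfolding min_transversal_def by auto
qed

lemma min_transversal_finiteD:
  assumes "min_transversal I A B \<noteq> \<infinity>"
  obtains h where "bij_betw h I B"
proof -
  have "{f. bij_betw f I B} \<noteq> {}"
    using assms unfolding min_transversal_def by (metis INF_empty top_ereal_def)
  thus ?thesis using that by auto
qed

lemma min_transversal_finite_attained:
  assumes "finite I" "min_transversal I A B \<noteq> \<infinity>"
  obtains f where "bij_betw f I B" "min_transversal I A B = (\<Sum>i\<in>I. A i (f i))"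
proof -
  obtain h where "bij_betw h I B" using assms(2) by (rule min_transversal_finiteD)
  thus ?thesis by (rule min_transversal_attained[OF assms(1)]) (rule that)
qed

lemma min_transversal_not_MInf:
  assumes "finite I" "\<And>i b. i \<in> I \<Longrightarrow> b \<in> B \<Longrightarrow> A i b \<noteq> -\<infinity>"
  shows "min_transversal I A B \<noteq> -\<infinity>"
proof (cases "min_transversal I A B = \<infinity>")
  case False
  then obtain f where f: "bij_betw f I B" "min_transversal I A B = (\<Sum>i\<in>I. A i (f i))"
    using assms(1) min_transversal_finite_attained by metis
  have "(\<Sum>i\<in>J. A i (f i)) \<noteq> -\<infinity>" if "J \<subseteq> I" for J
    using finite_subset[OF that assms(1)] that
    by (induction J rule: finite_induct) (use assms(2) bij_betwE[OF f(1)] in auto)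
  thus ?thesis using f(2) by simp
qed simp

lemma min_transversal_finite_iff:
  assumes "finite I" "\<And>i b. i \<in> I \<Longrightarrow> b \<in> B \<Longrightarrow> A i b \<noteq> -\<infinity>"
  shows "min_transversal I A B \<noteq> \<infinity> \<longleftrightarrow> (\<exists>f. bij_betw f I B \<and> (\<forall>i\<in>I. A i (f i) \<noteq> \<infinity>))"
proof
  assume "min_transversal I A B \<noteq> \<infinity>"
  moreover from this obtain f where "bij_betw f I B" "min_transversal I A B = (\<Sum>i\<in>I. A i (f i))"
    using assms(1) min_transversal_finite_attained by metis
  ultimately show "\<exists>f. bij_betw f I B \<and> (\<forall>i\<in>I. A i (f i) \<noteq> \<infinity>)"
    using assms(1) by (auto simp: sum_Pinfty)
next
  assume "\<exists>f. bij_betw f I B \<and> (\<forall>i\<in>I. A i (f i) \<noteq> \<infinity>)"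
  then obtain f where f: "bij_betw f I B" "\<forall>i\<in>I. A i (f i) \<noteq> \<infinity>" by auto
  have "(\<Sum>i\<in>I. A i (f i)) \<noteq> \<infinity>" using f assms(1) by (auto simp: sum_Pinfty)
  thus "min_transversal I A B \<noteq> \<infinity>" using min_transversal_le[OF f(1), of A] by auto
qed

lemma min_transversal_cong:
  assumes "\<And>i b. i \<in> I \<Longrightarrow> b \<in> B \<Longrightarrow> A i b = A' i b"
  shows "min_transversal I A B = min_transversal I A' B"
proof -
  have "(\<Sum>i\<in>I. A i (f i)) = (\<Sum>i\<in>I. A' i (f i))" if "bij_betw f I B" for f
    using assms bij_betwE[OF that] by (intro sum.cong) auto
  thus ?thesis unfolding min_transversal_def by (intro INF_cong) auto
qed

lemma min_transversal_mono:
  assumes "\<And>i b. i \<in> I \<Longrightarrow> b \<in> B \<Longrightarrow> A i b \<le> A' i b"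
  shows "min_transversal I A B \<le> min_transversal I A' B"
proof -
  have "(\<Sum>i\<in>I. A i (f i)) \<le> (\<Sum>i\<in>I. A' i (f i))" if "bij_betw f I B" for f
    using assms bij_betwE[OF that] by (intro sum_mono) auto
  thus ?thesis unfolding min_transversal_def by (intro INF_mono) auto
qed

text \<open>Tropical Laplace expansion along row \<open>i\<close>: every term bounds the minor from
  above. The next lemma shows that some term attains it.\<close>

lemma min_transversal_row_le:
  assumes "finite I" "i \<in> I" "b \<in> B" "A i b \<noteq> -\<infinity>"
  shows "min_transversal I A B \<le> A i b + min_transversal (I - {i}) A (B - {b})"
proof (cases "min_transversal (I - {i}) A (B - {b}) = \<infinity>")
  case False
  then obtain f where f: "bij_betw f (I - {i}) (B - {b})"
    "min_transversal (I - {i}) A (B - {b}) = (\<Sum>j\<in>I - {i}. A j (f j))"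
    using assms(1) min_transversal_finite_attained by (metis finite_Diff)
  have "bij_betw (f(i := b)) (I - {i}) (B - {b})"
    using f(1) by (subst bij_betw_cong[of _ _ f]) auto
  hence "bij_betw (f(i := b)) (insert i (I - {i})) (insert b (B - {b}))"
    using notIn_Un_bij_betw[of i "I - {i}" "f(i := b)" "B - {b}"] by simp
  hence "bij_betw (f(i := b)) I B" using assms by (simp add: insert_absorb)
  from min_transversal_le[OF this, of A] have
    "min_transversal I A B \<le> (\<Sum>j\<in>I. A j ((f(i := b)) j))" .
  also have "\<dots> = A i b + (\<Sum>j\<in>I - {i}. A j (f j))"
    using assms by (subst sum.remove[of _ i]) (auto intro!: sum.cong)
  finally show ?thesis using f by simp
qed (use assms in auto)

text \<open>Fix the entry that an optimal bijection uses in row \<open>i\<close>. An optimal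
  completion on the other rows can be glued to this entry, so the remainder of the bijection already
  has the value of the cofactor.\<close>

lemma min_transversal_row_attained:
  assumes "finite I" "i \<in> I" "bij_betw h I B"
  obtains b where "b \<in> B"
    "min_transversal I A B = A i b + min_transversal (I - {i}) A (B - {b})"
proof -
  obtain f where f: "bij_betw f I B" "min_transversal I A B = (\<Sum>j\<in>I. A j (f j))"
    using min_transversal_attained[OF assms(1,3)] by metis
  have fB: "f i \<in> B" using f(1) assms(2) bij_betwE by blast
  have bij: "bij_betw f (I - {i}) (B - {f i})"
    using f(1) assms(2) by (auto simp: bij_betw_def inj_on_image_set_diff[of f I] intro: inj_on_subset)
  obtain g where g: "bij_betw g (I - {i}) (B - {f i})"
    "min_transversal (I - {i}) A (B - {f i}) = (\<Sum>j\<in>I - {i}. A j (g j))"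
    using min_transversal_attained[OF _ bij] assms(1) by (metis finite_Diff)
  have "bij_betw (g(i := f i)) (I - {i}) (B - {f i})"
    using g(1) by (subst bij_betw_cong[of _ _ g]) auto
  hence "bij_betw (g(i := f i)) (insert i (I - {i})) (insert (f i) (B - {f i}))"
    using notIn_Un_bij_betw[of i "I - {i}" "g(i := f i)" "B - {f i}"] by simp
  hence "bij_betw (g(i := f i)) I B" using assms fB by (simp add: insert_absorb)
  from min_transversal_le[OF this, of A]
  have "min_transversal I A B \<le> (\<Sum>j\<in>I. A j ((g(i := f i)) j))" .
  also have "\<dots> = A i (f i) + (\<Sum>j\<in>I - {i}. A j (g j))"
    using assms by (subst sum.remove[of _ i]) (auto intro!: sum.cong)
  finally have "min_transversal I A B \<le> A i (f i) + min_transversal (I - {i}) A (B - {f i})"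
    using g by simp
  moreover have "min_transversal I A B = A i (f i) + (\<Sum>j\<in>I - {i}. A j (f j))"
    using f(2) assms by (simp add: sum.remove)
  hence "A i (f i) + min_transversal (I - {i}) A (B - {f i}) \<le> min_transversal I A B"
    using min_transversal_le[OF bij, of A] by (simp add: add_left_mono)
  ultimately show ?thesis using that[OF fB] by auto
qed

text \<open>Swap two optimal bijections along the path from \<open>swap_exchange\<close>. Each row
  keeps its two entries between them, so the total is unchanged, while it bounds the two new minors
  from above.\<close>

lemma min_transversal_exchange:
  assumes "finite I" "min_transversal I A C \<noteq> \<infinity>" "min_transversal I A C' \<noteq> \<infinity>" "e \<in> C - C'"
  shows "\<exists>b\<in>C' - C. min_transversal I A (insert b (C - {e})) + min_transversal I A (insert e (C' - {b}))
    \<le> min_transversal I A C + min_transversal I A C'"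
proof -
  obtain f where f: "bij_betw f I C" "min_transversal I A C = (\<Sum>i\<in>I. A i (f i))"
    using assms(1,2) min_transversal_finite_attained by metis
  obtain g where g: "bij_betw g I C'" "min_transversal I A C' = (\<Sum>i\<in>I. A i (g i))"
    using assms(1,3) min_transversal_finite_attained by metis
  have im: "f ` I = C" "g ` I = C'" "inj_on f I" "inj_on g I"
    using f(1) g(1) unfolding bij_betw_def by auto
  have "e \<in> f ` I - g ` I" using assms(4) unfolding im .
  from swap_exchange[OF assms(1) im(3,4) this]
  obtain J b where J: "b \<in> C' - C"
    "(\<lambda>i. if i \<in> J then g i else f i) ` I = insert b (C - {e})"
    "(\<lambda>i. if i \<in> J then f i else g i) ` I = insert e (C' - {b})"
    unfolding im(1,2) by (elim exE bexE conjE)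
  have fin: "finite C" "finite C'" using im assms(1) by auto
  have card: "card C = card I" "card C' = card I" using im card_image by auto
  have ins: "card (insert b (C - {e})) = card C" "card (insert e (C' - {b})) = card C'"
    using card_Suc_Diff1[OF fin(1), of e] card_Suc_Diff1[OF fin(2), of b] J(1) assms(4) fin
    by (simp_all add: card_insert_if)
  \<comment> \<open>Injectivity comes from counting: the image has as many elements as
    \<open>I\<close>.\<close>
  have "bij_betw (\<lambda>i. if i \<in> J then g i else f i) I (insert b (C - {e}))"
    unfolding bij_betw_def using J(2) ins card assms(1) by (auto intro!: eq_card_imp_inj_on)
  from min_transversal_le[OF this, of A]
  have 1: "min_transversal I A (insert b (C - {e})) \<le> (\<Sum>i\<in>I. A i (if i \<in> J then g i else f i))" .
  have "bij_betw (\<lambda>i. if i \<in> J then f i else g i) I (insert e (C' - {b}))"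
    unfolding bij_betw_def using J(3) ins card assms(1) by (auto intro!: eq_card_imp_inj_on)
  from min_transversal_le[OF this, of A]
  have 2: "min_transversal I A (insert e (C' - {b})) \<le> (\<Sum>i\<in>I. A i (if i \<in> J then f i else g i))" .
  have "(\<Sum>i\<in>I. A i (if i \<in> J then g i else f i)) + (\<Sum>i\<in>I. A i (if i \<in> J then f i else g i))
     = (\<Sum>i\<in>I. A i (f i)) + (\<Sum>i\<in>I. A i (g i))"
    unfolding sum.distrib[symmetric] by (intro sum.cong) (auto simp: add.commute)
  with add_mono[OF 1 2] show ?thesis using J(1) f(2) g(2) by auto
qed

section \<open>Set presentations and a criterion for minimality\<close>

text \<open>Any two listings of a multiset differ by a permutation of indices, which can be absorbed
  into the matching. This fixes one listing and turns matchings into maps from rows to elements, as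
  in \<open>min_transversal\<close>.\<close>

lemma matching_bases_mset_iff:
  "B \<in> matching_bases E (mset xs) \<longleftrightarrow>
    B \<subseteq> E \<and> (\<exists>f. bij_betw f {..<length xs} B \<and> (\<forall>i<length xs. f i \<in> xs ! i))"
proof (intro iffI conjI)
  assume "B \<in> matching_bases E (mset xs)"
  then obtain As \<phi> where *: "B \<subseteq> E" "mset As = mset xs" "bij_betw \<phi> B {..<length As}"
    "\<forall>b\<in>B. b \<in> As ! \<phi> b"
    unfolding matching_bases_def by auto
  thus "B \<subseteq> E" by simp
  obtain p where p: "bij_betw p {..<length xs} {..<length As}" "\<forall>i<length xs. xs ! i = As ! p i"
    using permutation_Ex_bij[of xs As] *(2) by auto
  let ?f = "inv_into B \<phi> \<circ> p"
  have "bij_betw ?f {..<length xs} B"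
    using p(1) bij_betw_inv_into[OF *(3)] bij_betw_trans by blast
  moreover have "?f i \<in> xs ! i" if "i < length xs" for i
  proof -
    have "p i \<in> {..<length As}" using p(1) that bij_betwE by blast
    hence "\<phi> (?f i) = p i" "?f i \<in> B"
      using *(3) by (auto simp: bij_betw_inv_into_right bij_betw_def inv_into_into)
    thus ?thesis using *(4) p(2) that by metis
  qed
  ultimately show "\<exists>f. bij_betw f {..<length xs} B \<and> (\<forall>i<length xs. f i \<in> xs ! i)" by blast
next
  assume "B \<subseteq> E \<and> (\<exists>f. bij_betw f {..<length xs} B \<and> (\<forall>i<length xs. f i \<in> xs ! i))"
  then obtain f where f: "B \<subseteq> E" "bij_betw f {..<length xs} B" "\<forall>i<length xs. f i \<in> xs ! i"
    by auto
  have "b \<in> xs ! inv_into {..<length xs} f b" if "b \<in> B" for b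
  proof -
    have "inv_into {..<length xs} f b \<in> {..<length xs}" "f (inv_into {..<length xs} f b) = b"
      using f(2) that bij_betwE[OF bij_betw_inv_into] bij_betw_inv_into_right by metis+
    thus ?thesis using f(3) by (metis lessThan_iff)
  qed
  thus "B \<in> matching_bases E (mset xs)"
    unfolding matching_bases_def using f(1) bij_betw_inv_into[OF f(2)] by blast
qed

text \<open>Representatives of the other members chosen outside \<open>xs ! i\<close>, together with
  any \<open>e\<close> in \<open>xs ! i\<close>, form a basis in which \<open>e\<close> is the only
  element that member \<open>i\<close> can take. A smaller presentation must also match this basis,
  so its member \<open>i\<close> still contains \<open>e\<close>.\<close>

lemma minimal_set_presentationI:
  assumes pres: "set_presentation E (length xs) \<B> (mset xs)"
    and avoid: "\<And>i. i < length xs \<Longrightarrow> \<exists>g. inj_on g ({..<length xs} - {i}) \<and>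
      (\<forall>j\<in>{..<length xs} - {i}. g j \<in> xs ! j - xs ! i)"
  shows "minimal_set_presentation E (length xs) \<B> (mset xs)"
  unfolding minimal_set_presentation_def
proof (intro conjI allI impI)
  fix \<A>' assume \<A>': "set_presentation E (length xs) \<B> \<A>' \<and> rel_mset (\<subseteq>) \<A>' (mset xs)"
  then obtain ys zs where "mset ys = \<A>'" "mset zs = mset xs" "list_all2 (\<subseteq>) ys zs"
    unfolding rel_mset_def by auto
  then obtain ys where ys: "mset ys = \<A>'" "list_all2 (\<subseteq>) ys xs"
    using list_all2_reorder_left_invariance[of "\<lambda>X Y. Y \<subseteq> X" zs ys xs]
    by (auto simp: list_all2_conv_all_nth)
  let ?d = "length xs"
  have len: "length ys = ?d" using ys(2) list_all2_lengthD by blast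
  have sub: "ys ! i \<subseteq> xs ! i" if "i < ?d" for i
    using ys(2) len that by (simp add: list_all2_conv_all_nth)
  have "xs ! i \<subseteq> ys ! i" if i: "i < ?d" for i
  proof
    fix e assume e: "e \<in> xs ! i"
    obtain g where g: "inj_on g ({..<?d} - {i})" "\<forall>j\<in>{..<?d} - {i}. g j \<in> xs ! j - xs ! i"
      using avoid[OF i] by auto
    let ?C = "g ` ({..<?d} - {i})"
    have "e \<notin> ?C" using g e by auto
    have "bij_betw (g(i := e)) ({..<?d} - {i}) ?C"
      using g(1) by (subst bij_betw_cong[of _ _ g]) (auto simp: bij_betw_def)
    hence "bij_betw (g(i := e)) (insert i ({..<?d} - {i})) (insert e ?C)"
      using notIn_Un_bij_betw[of i "{..<?d} - {i}" "g(i := e)" ?C] \<open>e \<notin> ?C\<close> by simp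
    hence bij: "bij_betw (g(i := e)) {..<?d} (insert e ?C)" using i by (simp add: insert_absorb)
    have "insert e ?C \<subseteq> E"
    proof -
      have "xs ! j \<subseteq> E" if "j < ?d" for j
        using pres that unfolding set_presentation_def by simp
      thus ?thesis using e i g(2) by auto
    qed
    moreover have "\<forall>j<?d. (g(i := e)) j \<in> xs ! j" using g(2) e by auto
    ultimately have "insert e ?C \<in> matching_bases E (mset xs)"
      using bij unfolding matching_bases_mset_iff by blast
    hence "insert e ?C \<in> matching_bases E (mset ys)"
      using pres \<A>' ys(1) unfolding set_presentation_def by simp
    then obtain f where f: "bij_betw f {..<?d} (insert e ?C)" "\<forall>j<?d. f j \<in> ys ! j"
      unfolding matching_bases_mset_iff len by auto
    have "f i \<in> insert e ?C" using f(1) i bij_betwE by blast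
    moreover have "f i \<in> ys ! i" "f i \<in> xs ! i" using f(2) i sub by auto
    ultimately show "e \<in> ys ! i" using g(2) by auto
  qed
  hence "ys = xs" using sub len by (intro nth_equalityI) auto
  thus "\<A>' = mset xs" using ys by simp
qed (rule pres)

section \<open>A basis of the remaining rows that avoids the support of one row\<close>

text \<open>\<open>irredundant\<close> constrains only the columns in \<open>E\<close>; the column
  \<open>star\<close> of a competing matrix is free. This permits lowering \<open>A i star\<close>
  before testing whether an entry in \<open>E\<close> can be erased.\<close>

lemma min_transversal_avoid_row:
  assumes I: "finite I" "i \<in> I" and E: "finite E" "star \<notin> E"
    and trop: "\<And>j b. j \<in> I \<Longrightarrow> b \<in> insert star E \<Longrightarrow> A j b \<noteq> -\<infinity>"
    and D0: "D0 \<subseteq> E" "min_transversal I A D0 \<noteq> \<infinity>"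
    and irredundant: "\<And>A' e. (\<And>j b. j \<in> I \<Longrightarrow> b \<in> insert star E \<Longrightarrow> A' j b \<noteq> -\<infinity>) \<Longrightarrow>
      (\<And>B. B \<subseteq> insert star E \<Longrightarrow> min_transversal I A' B = min_transversal I A B) \<Longrightarrow>
      (\<And>j b. j \<in> I \<Longrightarrow> b \<in> E \<Longrightarrow> A j b = \<infinity> \<Longrightarrow> A' j b = \<infinity>) \<Longrightarrow>
      e \<in> E \<Longrightarrow> A' i e = \<infinity> \<Longrightarrow> A i e = \<infinity>"
  shows "\<exists>C\<subseteq>E. min_transversal (I - {i}) A C \<noteq> \<infinity> \<and> (\<forall>c\<in>C. A i c = \<infinity>)"
proof -
  let ?E = "insert star E"
  define \<mu> where "\<mu> = min_transversal I A"
  define \<nu> where "\<nu> = min_transversal (I - {i}) A"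
  have \<nu>_MInf: "\<nu> C \<noteq> -\<infinity>" if "C \<subseteq> ?E" for C
    unfolding \<nu>_def using I trop that by (intro min_transversal_not_MInf) auto
  have \<mu>_MInf: "\<mu> C \<noteq> -\<infinity>" if "C \<subseteq> ?E" for C
    unfolding \<mu>_def using I trop that by (intro min_transversal_not_MInf) auto
  have \<mu>_le: "\<mu> B \<le> A i b + \<nu> (B - {b})" if "B \<subseteq> ?E" "b \<in> B" for B b
    unfolding \<mu>_def \<nu>_def using I trop that by (intro min_transversal_row_le) auto

  define N0 where "N0 = {D. D \<subseteq> E \<and> \<nu> D \<noteq> \<infinity>}"
  have finN0: "finite N0" unfolding N0_def using E(1) by auto
  obtain h where "bij_betw h I D0" using D0(2) by (rule min_transversal_finiteD)
  from min_transversal_row_attained[OF I this, of A]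
  obtain b0 where "b0 \<in> D0" "\<mu> D0 = A i b0 + \<nu> (D0 - {b0})"
    unfolding \<mu>_def \<nu>_def by metis
  hence "D0 - {b0} \<in> N0" using D0 unfolding N0_def \<mu>_def by auto
  hence ne: "N0 \<noteq> {}" by auto

  text \<open>The smallest value to which the entry \<^term>\<open>A i star\<close> can be lowered.\<close>
  define t where "t = Max ((\<lambda>D. \<mu> (insert star D) - \<nu> D) ` N0)"
  have "t \<in> (\<lambda>D. \<mu> (insert star D) - \<nu> D) ` N0"
    unfolding t_def using finN0 ne by (intro Max_in) auto
  then obtain D where D: "D \<in> N0" "t = \<mu> (insert star D) - \<nu> D" by auto
  have finite_\<nu>: "\<bar>\<nu> C\<bar> \<noteq> \<infinity>" if "C \<in> N0" for C
    using that \<nu>_MInf[of C] unfolding N0_def by auto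
  have cancel: "\<mu> (insert star C) - \<nu> C + \<nu> C = \<mu> (insert star C)" if "C \<in> N0" for C
    using finite_\<nu>[OF that] by (cases "\<mu> (insert star C)"; cases "\<nu> C") auto
  \<comment> \<open>At the maximiser \<open>D\<close> the term of column \<open>star\<close> is
    optimal in the expansion of \<open>\<mu> (insert star D)\<close>. No other column gives a
    smaller term, which is what \<open>exchange_avoid\<close> asks of its set
    \<open>D\<close>.\<close>
  have tD: "t + \<nu> D = \<mu> (insert star D)" using cancel[OF D(1)] D(2) by simp
  have t_ge: "\<mu> (insert star C) \<le> t + \<nu> C" if "C \<in> N0" for C
  proof -
    have "\<mu> (insert star C) - \<nu> C \<le> t" unfolding t_def using that finN0 by auto
    from add_right_mono[OF this, of "\<nu> C"] show ?thesis using cancel[OF that] by simp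
  qed
  have DE: "D \<subseteq> E" "star \<notin> D" using D E unfolding N0_def by auto
  have t_MInf: "t \<noteq> -\<infinity>"
    using \<mu>_MInf[of "insert star D"] DE finite_\<nu>[OF D(1)] unfolding D(2)
    by (cases "\<mu> (insert star D)"; cases "\<nu> D") auto
  have "t + \<nu> D \<le> A i star + \<nu> D"
    unfolding tD using \<mu>_le[of "insert star D" star] DE by auto
  hence t_le: "t \<le> A i star"
    using finite_\<nu>[OF D(1)] t_MInf trop[OF I(2), of star]
    by (cases t; cases "A i star"; cases "\<nu> D") auto

  define y where "y = (A i)(star := t)"
  \<comment> \<open>Lowering the entry to \<open>t\<close> can only lower minors, and
    \<open>t_ge\<close> keeps every expansion term using \<open>star\<close> at or above
    \<open>\<mu>\<close>. So \<open>A1\<close> has the same minors as \<open>A\<close>.\<close>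
  define A1 where "A1 = A(i := y)"
  have \<nu>1: "min_transversal (I - {i}) (A(i := z)) B = \<nu> B" for z B
    unfolding \<nu>_def by (intro min_transversal_cong) auto
  have y_MInf: "y b \<noteq> -\<infinity>" if "b \<in> ?E" for b
    unfolding y_def using trop[OF I(2) that] t_MInf by auto
  have attained1: "\<exists>b\<in>B. min_transversal I A1 B = y b + \<nu> (B - {b})"
    if fin: "min_transversal I A1 B \<noteq> \<infinity>" for B
  proof -
    obtain h where "bij_betw h I B" using fin by (rule min_transversal_finiteD)
    from min_transversal_row_attained[OF I this, of A1] show ?thesis
      unfolding A1_def \<nu>1 fun_upd_same by blast
  qed
  have pres1: "min_transversal I A1 B = \<mu> B" if B: "B \<subseteq> ?E" for B
  proof (rule antisym)
    show "min_transversal I A1 B \<le> \<mu> B"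
      unfolding \<mu>_def A1_def y_def using t_le by (intro min_transversal_mono) auto
    show "\<mu> B \<le> min_transversal I A1 B"
    proof (cases "min_transversal I A1 B = \<infinity>")
      case False
      then obtain b where b: "b \<in> B" "min_transversal I A1 B = y b + \<nu> (B - {b})"
        using attained1 by blast
      show ?thesis
      proof (cases "b = star")
        case True
        have "B - {star} \<in> N0" using b False True B unfolding N0_def by auto
        from t_ge[OF this] show ?thesis using b True by (simp add: y_def insert_absorb)
      next
        case False
        thus ?thesis using \<mu>_le[OF B b(1)] b(2) by (simp add: y_def)
      qed
    qed simp
  qed

  define S where "S = {b \<in> ?E. y b \<noteq> \<infinity>}"
  \<comment> \<open>For \<open>b\<close> in \<open>B \<inter> S\<close> with a finite cofactor, the
    expansion term \<open>y b + \<nu> (B - {b})\<close> equals \<open>w (B - {b})\<close> plus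
    \<open>sum r B\<close>. Comparing terms for one \<open>B\<close> is thus comparing values of
    \<open>w\<close>. The default 0 off \<open>S\<close> keeps \<open>r\<close> real, and the
    exchange inequality survives subtraction of any sum over elements.\<close>
  define r where "r b = (if b \<in> S then real_of_ereal (y b) else 0)" for b
  define w where "w C = real_of_ereal (\<nu> C) - sum r C" for C
  define N where "N = {C. C \<subseteq> ?E \<and> \<nu> C \<noteq> \<infinity>}"
  have finC: "finite C" if "C \<in> N" for C
    using that E(1) finite_subset unfolding N_def by (metis finite_insert mem_Collect_eq)
  have finN: "finite N" unfolding N_def using E(1) by auto
  have real_\<nu>: "\<nu> C = ereal (real_of_ereal (\<nu> C))" if "C \<in> N" for C
    using that \<nu>_MInf[of C] unfolding N_def by (cases "\<nu> C") auto
  have real_y: "y b = ereal (r b)" if "b \<in> S" for b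
    using that y_MInf[of b] unfolding r_def S_def by (cases "y b") auto
  have sum_swap: "sum r (insert b (C - {e})) = sum r C - r e + r b"
    if "finite C" "e \<in> C" "b \<notin> C" for b e C
    using that by (simp add: sum_diff1)

  have "\<exists>C\<in>N. star \<notin> C \<and> C \<inter> S = {}"
  proof (rule exchange_avoid[OF finN finC, where w = w and D = D])
    fix C C' e assume C: "C \<in> N" "C' \<in> N" "e \<in> C - C'"
    hence "min_transversal (I - {i}) A C \<noteq> \<infinity>" "min_transversal (I - {i}) A C' \<noteq> \<infinity>"
      unfolding N_def \<nu>_def by auto
    from min_transversal_exchange[OF _ this C(3)] I(1) obtain b where b: "b \<in> C' - C"
      "\<nu> (insert b (C - {e})) + \<nu> (insert e (C' - {b})) \<le> \<nu> C + \<nu> C'"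
      unfolding \<nu>_def by auto
    have "\<nu> C + \<nu> C' \<noteq> \<infinity>" using C unfolding N_def by auto
    hence fin: "\<nu> (insert b (C - {e})) \<noteq> \<infinity>" "\<nu> (insert e (C' - {b})) \<noteq> \<infinity>"
      using b(2) by auto
    have N: "insert b (C - {e}) \<in> N" "insert e (C' - {b}) \<in> N"
      using C b(1) fin unfolding N_def by auto
    have "real_of_ereal (\<nu> (insert b (C - {e}))) + real_of_ereal (\<nu> (insert e (C' - {b})))
      \<le> real_of_ereal (\<nu> C) + real_of_ereal (\<nu> C')"
      using b(2) real_\<nu>[OF N(1)] real_\<nu>[OF N(2)] real_\<nu>[OF C(1)] real_\<nu>[OF C(2)]
      by (metis ereal_less_eq(3) plus_ereal.simps(1))
    moreover have "sum r (insert b (C - {e})) = sum r C - r e + r b"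
      using C b finC by (intro sum_swap) auto
    moreover have "sum r (insert e (C' - {b})) = sum r C' - r b + r e"
      using C b finC by (intro sum_swap) auto
    ultimately have "w (insert b (C - {e})) + w (insert e (C' - {b})) \<le> w C + w C'"
      unfolding w_def by linarith
    thus "\<exists>b\<in>C' - C. insert b (C - {e}) \<in> N \<and> insert e (C' - {b}) \<in> N \<and>
        w (insert b (C - {e})) + w (insert e (C' - {b})) \<le> w C + w C'"
      using b(1) N by blast
  next
    fix e assume e: "e \<in> S - {star}"
    hence eE: "e \<in> E" "A i e \<noteq> \<infinity>" unfolding S_def y_def by auto
    \<comment> \<open>Erasing \<open>e\<close> from the lowered row must change, hence raise, some
      minor \<open>B\<close>. Every optimal term of \<open>B\<close> therefore uses column
      \<open>e\<close>, and \<open>B - {e}\<close> is the set required by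
      \<open>strict\<close>.\<close>
    define A2 where "A2 = A(i := y(e := \<infinity>))"
    have "\<exists>B\<subseteq>?E. min_transversal I A2 B \<noteq> \<mu> B"
    proof (rule ccontr)
      assume "\<not> ?thesis"
      hence "A i e = \<infinity>"
        using trop y_MInf eE E
        by (intro irredundant[of A2]) (auto simp: A2_def \<mu>_def y_def)
      thus False using eE by simp
    qed
    then obtain B where B: "B \<subseteq> ?E" "min_transversal I A2 B \<noteq> \<mu> B" by auto
    have "min_transversal I A1 B \<le> min_transversal I A2 B"
      unfolding A1_def A2_def by (intro min_transversal_mono) auto
    hence less: "\<mu> B < min_transversal I A2 B" using B pres1[OF B(1)] by auto
    have le2: "min_transversal I A2 B \<le> y b + \<nu> (B - {b})" if "b \<in> B" "b \<noteq> e" for b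
    proof -
      have "min_transversal I A2 B \<le> A2 i b + min_transversal (I - {i}) A2 (B - {b})"
        using I that B(1) y_MInf by (intro min_transversal_row_le) (auto simp: A2_def)
      thus ?thesis using that unfolding A2_def \<nu>1 by simp
    qed
    have fin: "\<mu> B \<noteq> \<infinity>" using less by auto
    then obtain b where b: "b \<in> B" "\<mu> B = y b + \<nu> (B - {b})"
      using attained1[of B] pres1[OF B(1)] by auto
    have "b = e" using le2[OF b(1)] less b(2) by (metis not_le)
    with b have eB: "e \<in> B" "\<mu> B = y e + \<nu> (B - {e})" by auto
    let ?C = "B - {e}"
    have CN: "?C \<in> N" using eB(2) fin B(1) unfolding N_def by auto
    have "w ?C < w (insert e (?C - {b}))" if b: "b \<in> ?C \<inter> S" "insert e (?C - {b}) \<in> N" for b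
    proof -
      have eq: "insert e (?C - {b}) = B - {b}" using b eB by auto
      have "y e + \<nu> ?C < y b + \<nu> (insert e (?C - {b}))"
        unfolding eq using less le2[of b] b eB(2) by auto
      hence "r e + real_of_ereal (\<nu> ?C) < r b + real_of_ereal (\<nu> (insert e (?C - {b})))"
        using real_\<nu>[OF CN] real_\<nu>[OF b(2)] real_y[of e] real_y[of b] e b
        by (metis DiffD1 IntD2 less_ereal.simps(1) plus_ereal.simps(1))
      moreover have "sum r (insert e (?C - {b})) = sum r ?C - r b + r e"
        using finC[OF CN] b by (intro sum_swap) auto
      ultimately show ?thesis unfolding w_def by linarith
    qed
    thus "\<exists>C\<in>N. e \<notin> C \<and> (\<forall>b\<in>C \<inter> S. insert e (C - {b}) \<in> N \<longrightarrow> w C < w (insert e (C - {b})))"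
      using CN by blast
  next
    show DN: "D \<in> N" using D unfolding N_def N0_def by auto
    show "star \<notin> D" by (rule DE)
    fix b assume b: "b \<in> D \<inter> S" "insert star (D - {b}) \<in> N"
    have bs: "b \<noteq> star" using b DE by auto
    have eq: "insert star D - {b} = insert star (D - {b})" using bs by auto
    have le: "t + \<nu> D \<le> y b + \<nu> (insert star (D - {b}))"
      unfolding tD eq[symmetric] using \<mu>_le[of "insert star D" b] b bs DE by (auto simp: y_def)
    have "y b + \<nu> (insert star (D - {b})) \<noteq> \<infinity>"
      using b unfolding N_def S_def by auto
    hence "t \<noteq> \<infinity>" using le by auto
    hence sS: "star \<in> S" unfolding S_def y_def by auto
    have "y star + \<nu> D \<le> y b + \<nu> (insert star (D - {b}))" using le by (simp add: y_def)
    hence "r star + real_of_ereal (\<nu> D) \<le> r b + real_of_ereal (\<nu> (insert star (D - {b})))"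
      using real_\<nu>[OF DN] real_\<nu>[OF b(2)] real_y[OF sS] real_y[of b] b
      by (metis IntD2 ereal_less_eq(3) plus_ereal.simps(1))
    moreover have "sum r (insert star (D - {b})) = sum r D - r b + r star"
      using finC[OF DN] b DE by (intro sum_swap) auto
    ultimately show "star \<in> S \<and> w D \<le> w (insert star (D - {b}))"
      using sS unfolding w_def by linarith
  qed
  then obtain C where C: "C \<in> N" "star \<notin> C" "C \<inter> S = {}" by auto
  \<comment> \<open>Away from \<open>star\<close>, the lowered row agrees with the original
    one.\<close>
  have "A i c = \<infinity>" if "c \<in> C" for c
  proof -
    have "c \<noteq> star" "c \<in> ?E" "c \<notin> S" using C that unfolding N_def by auto
    thus ?thesis unfolding S_def y_def by auto
  qed
  thus ?thesis using C unfolding N_def \<nu>_def by (intro exI[of _ C]) auto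
qed

section \<open>A presentation with the fewest finite entries in the columns of
  \<open>E\<close>\<close>

theorem theorem4p5:
  fixes E :: "'a set" and star :: 'a and d :: nat and \<mu>' :: "'a set \<Rightarrow> ereal"
  assumes "finite E"
    and "star \<notin> E"
    and "transversal_valuated_matroid (insert star E) d \<mu>'"
    and "\<not> coloop (underlying_bases (insert star E) d \<mu>') star"
  shows "\<exists>A x. matrix_presentation (insert star E) d \<mu>' (append_column A star x) \<and>
               minimal_matrix_presentation E d (valuated_deletion (insert star E) d \<mu>' star) A"
proof -
  let ?E = "insert star E"
  \<comment> \<open>The column \<open>star\<close> is left out of the count, so changes there cost
    nothing.\<close>
  define cnt where "cnt A = card {(i, e). i < d \<and> e \<in> E \<and> A i e \<noteq> (\<infinity> :: ereal)}" for A
  obtain A where pres: "matrix_presentation ?E d \<mu>' A"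
    and least: "\<And>A'. matrix_presentation ?E d \<mu>' A' \<Longrightarrow> cnt A \<le> cnt A'"
    using assms(3) ex_has_least_nat[of "matrix_presentation ?E d \<mu>'" _ cnt]
    unfolding transversal_valuated_matroid_def by blast
  have trop: "A j b \<noteq> -\<infinity>" if "j < d" "b \<in> ?E" for j b
    using pres that unfolding matrix_presentation_def tropical_matrix_def tropical_def by auto
  obtain c where c: "\<And>B. B \<in> nsets ?E d \<Longrightarrow> \<mu>' B = min_transversal {..<d} A B + ereal c"
    using pres unfolding matrix_presentation_def valuation_equiv_def
      tropical_stiefel_eq_min_transversal by auto
  \<comment> \<open>Since \<open>star\<close> is not a coloop, some basis lies in \<open>E\<close>;
    it gives a finite minor of \<open>A\<close> without that column.\<close>
  obtain D0 where D0: "D0 \<in> nsets ?E d" "\<mu>' D0 \<in> range ereal" "star \<notin> D0"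
    using assms(4) unfolding coloop_def underlying_bases_def by auto
  have D0': "D0 \<subseteq> E" "min_transversal {..<d} A D0 \<noteq> \<infinity>"
    using D0 c[OF D0(1)] unfolding nsets_def by auto

  have avoid: "\<exists>C\<subseteq>E. min_transversal ({..<d} - {i}) A C \<noteq> \<infinity> \<and> (\<forall>c\<in>C. A i c = \<infinity>)"
    if i: "i < d" for i
  proof (rule min_transversal_avoid_row[OF _ _ assms(1,2) _ D0'])
    fix A' e
    assume trop': "\<And>j b. j \<in> {..<d} \<Longrightarrow> b \<in> ?E \<Longrightarrow> A' j b \<noteq> -\<infinity>"
      and same: "\<And>B. B \<subseteq> ?E \<Longrightarrow> min_transversal {..<d} A' B = min_transversal {..<d} A B"
      and sparser: "\<And>j b. j \<in> {..<d} \<Longrightarrow> b \<in> E \<Longrightarrow> A j b = \<infinity> \<Longrightarrow> A' j b = \<infinity>"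
      and e: "e \<in> E" "A' i e = \<infinity>"
    have "matrix_presentation ?E d \<mu>' A'"
      unfolding matrix_presentation_def valuation_equiv_def tropical_stiefel_eq_min_transversal
        tropical_matrix_def tropical_def
      using trop' c same by (auto simp: nsets_def intro!: exI[of _ c])
    hence le: "cnt A \<le> cnt A'" by (rule least)
    show "A i e = \<infinity>"
    proof (rule ccontr)
      assume ne: "A i e \<noteq> \<infinity>"
      have "finite ({..<d} \<times> E)" using assms(1) by simp
      hence "finite {(i, e). i < d \<and> e \<in> E \<and> A i e \<noteq> \<infinity>}"
        by (rule finite_subset[rotated]) auto
      moreover have "{(i, e). i < d \<and> e \<in> E \<and> A' i e \<noteq> \<infinity>} \<subset> {(i, e). i < d \<and> e \<in> E \<and> A i e \<noteq> \<infinity>}"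
      proof (rule psubsetI)
        show "{(i, e). i < d \<and> e \<in> E \<and> A' i e \<noteq> \<infinity>} \<subseteq> {(i, e). i < d \<and> e \<in> E \<and> A i e \<noteq> \<infinity>}"
          using sparser by auto
        show "{(i, e). i < d \<and> e \<in> E \<and> A' i e \<noteq> \<infinity>} \<noteq> {(i, e). i < d \<and> e \<in> E \<and> A i e \<noteq> \<infinity>}"
          using i e ne by blast
      qed
      ultimately have "cnt A' < cnt A" unfolding cnt_def by (rule psubset_card_mono)
      thus False using le by simp
    qed
  qed (use i trop in auto)

  define xs where "xs = map (\<lambda>i. trop_support E (A i)) [0..<d]"
  have len: "length xs = d" unfolding xs_def by simp
  have nth: "xs ! i = trop_support E (A i)" if "i < d" for i
    using that unfolding xs_def by simp
  have rows: "row_supports E d A = mset xs"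
    unfolding row_supports_def xs_def by (simp add: atLeast0LessThan)
  let ?\<mu> = "valuated_deletion ?E d \<mu>' star"
  have E: "?E - {star} = E" using assms(2) by auto
  have sub: "nsets E d \<subseteq> nsets ?E d" unfolding nsets_def by auto
  have \<mu>: "?\<mu> B = min_transversal {..<d} A B + ereal c" if "B \<in> nsets E d" for B
    using that c sub unfolding valuated_deletion_def E by auto

  have iff: "B \<in> underlying_bases E d ?\<mu> \<longleftrightarrow> B \<in> matching_bases E (mset xs)" for B
  proof -
    have card: "B \<in> nsets E d" if "B \<subseteq> E" "bij_betw f {..<d} B" for f
      using that assms(1) bij_betw_same_card[OF that(2)]
      by (auto simp: nsets_def intro: finite_subset)
    have fin: "?\<mu> B \<in> range ereal \<longleftrightarrow>
        (\<exists>f. bij_betw f {..<d} B \<and> (\<forall>i\<in>{..<d}. A i (f i) \<noteq> \<infinity>))" if B: "B \<in> nsets E d"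
    proof -
      have BE: "B \<subseteq> ?E" using B unfolding nsets_def by auto
      have "min_transversal {..<d} A B \<noteq> -\<infinity>"
        using trop BE by (intro min_transversal_not_MInf) auto
      hence "?\<mu> B \<in> range ereal \<longleftrightarrow> min_transversal {..<d} A B \<noteq> \<infinity>"
        unfolding \<mu>[OF B] by (cases "min_transversal {..<d} A B") auto
      also have "\<dots> \<longleftrightarrow> (\<exists>f. bij_betw f {..<d} B \<and> (\<forall>i\<in>{..<d}. A i (f i) \<noteq> \<infinity>))"
        using trop BE by (intro min_transversal_finite_iff) auto
      finally show ?thesis .
    qed
    have supp: "(\<forall>i<d. f i \<in> xs ! i) \<longleftrightarrow> (\<forall>i\<in>{..<d}. A i (f i) \<noteq> \<infinity>)"
      if "B \<subseteq> E" "bij_betw f {..<d} B" for f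
      using that(1) bij_betwE[OF that(2)] nth unfolding trop_support_def by auto
    show ?thesis
    proof
      assume "B \<in> underlying_bases E d ?\<mu>"
      hence B: "B \<in> nsets E d" "?\<mu> B \<in> range ereal" unfolding underlying_bases_def by auto
      hence "B \<subseteq> E" unfolding nsets_def by auto
      with B fin supp show "B \<in> matching_bases E (mset xs)"
        unfolding matching_bases_mset_iff len by blast
    next
      assume "B \<in> matching_bases E (mset xs)"
      then obtain f where f: "B \<subseteq> E" "bij_betw f {..<d} B" "\<forall>i<d. f i \<in> xs ! i"
        unfolding matching_bases_mset_iff len by auto
      have "B \<in> nsets E d" by (rule card[OF f(1,2)])
      moreover have "?\<mu> B \<in> range ereal" using fin[OF card[OF f(1,2)]] f supp[OF f(1,2)] by blast
      ultimately show "B \<in> underlying_bases E d ?\<mu>" unfolding underlying_bases_def by simp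
    qed
  qed

  have "set_presentation E d (underlying_bases E d ?\<mu>) (mset xs)"
    unfolding set_presentation_def using iff by (auto simp: xs_def trop_support_def)
  moreover have "\<exists>g. inj_on g ({..<d} - {i}) \<and> (\<forall>j\<in>{..<d} - {i}. g j \<in> xs ! j - xs ! i)"
    if i: "i < d" for i
  proof -
    \<comment> \<open>A finite minor of the other rows on \<open>C\<close> is a matching of their
      supports into \<open>C\<close>, which misses the support of row \<open>i\<close>. This
      provides the representatives for \<open>minimal_set_presentationI\<close>.\<close>
    obtain C where C: "C \<subseteq> E" "min_transversal ({..<d} - {i}) A C \<noteq> \<infinity>" "\<forall>c\<in>C. A i c = \<infinity>"
      using avoid[OF i] by blast
    have "\<exists>g. bij_betw g ({..<d} - {i}) C \<and> (\<forall>j\<in>{..<d} - {i}. A j (g j) \<noteq> \<infinity>)"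
      using C(1,2) trop by (subst min_transversal_finite_iff[symmetric]) auto
    then obtain g where g: "bij_betw g ({..<d} - {i}) C"
      "\<forall>j\<in>{..<d} - {i}. A j (g j) \<noteq> \<infinity>" by blast
    have "g j \<in> xs ! j - xs ! i" if j: "j \<in> {..<d} - {i}" for j
    proof -
      have "g j \<in> C" using g(1) j bij_betwE by blast
      thus ?thesis using C g(2) i j nth unfolding trop_support_def by auto
    qed
    thus ?thesis using g(1) unfolding bij_betw_def by blast
  qed
  ultimately have "minimal_set_presentation E d (underlying_bases E d ?\<mu>) (mset xs)"
    using minimal_set_presentationI[of E xs] unfolding len by blast
  moreover have "matrix_presentation E d ?\<mu> A"
    unfolding matrix_presentation_def valuation_equiv_def tropical_stiefel_eq_min_transversal
      tropical_matrix_def tropical_def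
    using trop \<mu> by auto
  \<comment> \<open>Matrices are total functions, so \<open>A\<close> itself serves both as the full
    matrix and as its block on \<open>E\<close>.\<close>
  moreover have "append_column A star (\<lambda>i. A i star) = A"
    unfolding append_column_def by auto
  ultimately show ?thesis
    using pres rows unfolding minimal_matrix_presentation_def by metis
qed

end
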